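(* Let $G$ be a group with an infinite conjugacy class $Y$, and let $W \subset FC(G)$ be finite. Then for every pair of finite subsets $E, F \subset Y$ there exists $g \in C_G(W)$ such that $gEg^{-1} \cap F = \emptyset$.
   Context: $FC(G)=\{t\in G : \text{the conjugacy class of } t \text{ in } G \text{ is finite}\}$. $C_G(W)=\{g\in G : gw=wg \ (w\in W)\}$ is the centraliser of $W$ in $G$. *)

theory Defs
  imports "HOL-Algebra.Group_Action"
begin

definition conj_class :: "('a, 'b) monoid_scheme \<Rightarrow> 'a \<Rightarrow> 'a set" where
  "conj_class G t =
     orbit G (\<lambda>g. \<lambda>h \<in> carrier G. g \<otimes>\<^bsub>G\<^esub> h \<otimes>\<^bsub>G\<^esub> inv\<^bsub>G\<^esub> g) t"

lemma conj_class_eq: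
  assumes "t \<in> carrier G"
  shows "conj_class G t = {g \<otimes>\<^bsub>G\<^esub> t \<otimes>\<^bsub>G\<^esub> inv\<^bsub>G\<^esub> g | g. g \<in> carrier G}"
  using assms by (simp add: conj_class_def orbit_def)

definition FC :: "('a, 'b) monoid_scheme \<Rightarrow> 'a set" where
  "FC G = {t \<in> carrier G. finite (conj_class G t)}"

definition centraliser :: "('a, 'b) monoid_scheme \<Rightarrow> 'a set \<Rightarrow> 'a set" where
  "centraliser G W = {g \<in> carrier G. \<forall>w \<in> W. g \<otimes>\<^bsub>G\<^esub> w = w \<otimes>\<^bsub>G\<^esub> g}"

end

theory Submission
  imports Defs
begin

text \<open>
  The centraliser \<open>C\<close> of \<open>W\<close> has finite index: the coset of \<open>g\<close> modulo \<open>C\<close> is determined by the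
  conjugates of the finitely many elements of \<open>W\<close> by \<open>g\<close>, and each of these conjugates ranges over
  a finite class (\<open>finite_transversal_centraliser\<close>). Hence \<open>C\<close>, acting by conjugation, still has an
  infinite orbit at every point of \<open>Y\<close>, because finitely many translates of a \<open>C\<close>-orbit cover \<open>Y\<close>
  (\<open>infinite_orbit_finite_index\<close>). What remains is a fact about arbitrary actions, Peter Neumann's
  separation lemma: a finite set of points with infinite orbits can be moved off any finite set
  (\<open>separate_finite_sets\<close>). It is often deduced from B. H. Neumann's theorem on coverings of a group
  by cosets; the direct induction on the set of points below uses the idea of that theorem's proof.
\<close>

text \<open>
  Suppose every group element moves some point of \<open>insert x A\<close> into \<open>B\<close>. Since the orbit of \<open>x\<close> is
  infinite, some translate \<open>k x\<close> lies outside \<open>B\<close>, so an element that agrees with \<open>k\<close> at \<open>x\<close> must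
  move a point of \<open>A\<close> into \<open>B\<close>. An element \<open>g\<close> with \<open>g x \<in> B\<close> becomes of this kind after a left
  translation that depends only on the value \<open>g x\<close>. Thus every element moves a point of \<open>A\<close> into one
  larger set, still finite because only finitely many translations occur, against the induction
  hypothesis. For this reason the induction is on \<open>A\<close> with \<open>B\<close> arbitrary.
\<close>

lemma (in group_action) separate_finite_sets:
  assumes "finite A" and "A \<subseteq> E" and "\<And>x. x \<in> A \<Longrightarrow> infinite (orbit G \<phi> x)" and "finite B"
  shows "\<exists>g \<in> carrier G. \<phi> g ` A \<inter> B = {}"
  using assms
proof (induction A arbitrary: B rule: finite_induct)
  case empty
  interpret group G using group_hom group_hom.axioms(1) by auto
  show ?case by auto
next
  case (insert x A)
  interpret group G using group_hom group_hom.axioms(1) by auto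
  have x: "x \<in> E" and A: "A \<subseteq> E" using insert.prems(1) by auto
  have "\<not> orbit G \<phi> x \<subseteq> B"
    using insert.prems(2,3) finite_subset by blast
  then obtain k where k: "k \<in> carrier G" "\<phi> k x \<notin> B"
    by (auto simp: orbit_def)
  define r where "r b = (SOME h. h \<in> carrier G \<and> \<phi> h x = b)" for b
  have r: "r (\<phi> g x) \<in> carrier G" "\<phi> (r (\<phi> g x)) x = \<phi> g x" if "g \<in> carrier G" for g
    using someI[of "\<lambda>h. h \<in> carrier G \<and> \<phi> h x = \<phi> g x" g] that by (auto simp: r_def)
  define B' where "B' = B \<union> (\<Union>b\<in>B. \<phi> (r b \<otimes> inv k) ` B)"
  have "finite B'" using insert.prems(3) by (simp add: B'_def)
  with insert.IH[OF A] insert.prems(2) obtain g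
    where g: "g \<in> carrier G" and off: "\<phi> g ` A \<inter> B' = {}" by blast
  show ?case
  proof (cases "\<phi> g x \<in> B")
    case False
    with off g show ?thesis by (auto simp: B'_def)
  next
    case True
    define s where "s = r (\<phi> g x) \<otimes> inv k"
    have s: "s \<in> carrier G" using r[OF g] k by (simp add: s_def)
    have "\<phi> (inv (r (\<phi> g x))) (\<phi> g x) = x"
      using orbit_sym_aux[OF r(1)[OF g] x r(2)[OF g]] .
    \<comment> \<open>Left translation by the inverse of \<open>s\<close> turns \<open>g\<close> into an element agreeing with \<open>k\<close> at \<open>x\<close>.\<close>
    then have "\<phi> (inv s \<otimes> g) x = \<phi> k x"
      using r[OF g] k g x element_image[OF g x refl]
      by (simp add: s_def inv_mult_group composition_rule)
    moreover have "\<phi> (inv s \<otimes> g) a \<notin> B" if a: "a \<in> A" for a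
    proof
      assume in_B: "\<phi> (inv s \<otimes> g) a \<in> B"
      have aE: "a \<in> E" using a A by auto
      have "\<phi> s (\<phi> (inv s \<otimes> g) a) = \<phi> (s \<otimes> (inv s \<otimes> g)) a"
        using s g aE by (simp add: composition_rule)
      also have "\<dots> = \<phi> g a"
        using s g by (simp add: m_assoc[symmetric])
      finally have "\<phi> g a \<in> \<phi> s ` B" using in_B by (metis imageI)
      then have "\<phi> g a \<in> B'" using True by (auto simp: B'_def s_def)
      with off a show False by auto
    qed
    ultimately have "\<phi> (inv s \<otimes> g) ` insert x A \<inter> B = {}" using k by auto
    then show ?thesis using s g by (intro bexI[of _ "inv s \<otimes> g"]) auto
  qed
qed

text \<open>
  Finite index enters as a finite set \<open>T\<close> meeting every left coset, so that the orbit under the whole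
  group is the union of the \<open>T\<close>-translates of the orbit under the subgroup.
\<close>

lemma (in group_action) infinite_orbit_finite_index:
  assumes H: "subgroup H G" and T: "finite T" "T \<subseteq> carrier G" "carrier G \<subseteq> T <#> H"
    and x: "x \<in> E" "infinite (orbit G \<phi> x)"
  shows "infinite (orbit (G\<lparr>carrier := H\<rparr>) \<phi> x)"
proof
  assume fin: "finite (orbit (G\<lparr>carrier := H\<rparr>) \<phi> x)"
  have "orbit G \<phi> x \<subseteq> (\<Union>t\<in>T. \<phi> t ` orbit (G\<lparr>carrier := H\<rparr>) \<phi> x)"
  proof
    fix z assume "z \<in> orbit G \<phi> x"
    then obtain g where g: "g \<in> carrier G" "z = \<phi> g x" by (auto simp: orbit_def)
    then obtain t h where th: "t \<in> T" "h \<in> H" "g = t \<otimes> h"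
      using T(3) by (auto simp: set_mult_def)
    then have "z = \<phi> t (\<phi> h x)"
      using g x T(2) subgroup.subset[OF H] by (auto simp: composition_rule subset_iff)
    with th show "z \<in> (\<Union>t\<in>T. \<phi> t ` orbit (G\<lparr>carrier := H\<rparr>) \<phi> x)"
      by (auto simp: orbit_def)
  qed
  then show False using fin T(1) x(2) finite_subset by blast
qed

lemma (in group) centraliser_subgroup:
  assumes "W \<subseteq> carrier G"
  shows "subgroup (centraliser G W) G"
proof (rule subgroupI)
  show "centraliser G W \<subseteq> carrier G" by (auto simp: centraliser_def)
  have "\<one> \<in> centraliser G W" using assms by (auto simp: centraliser_def)
  then show "centraliser G W \<noteq> {}" by auto
next
  fix a assume a: "a \<in> centraliser G W"
  have "inv a \<otimes> w = w \<otimes> inv a" if "w \<in> W" for w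
  proof -
    have "a \<in> carrier G" "w \<in> carrier G" "a \<otimes> w = w \<otimes> a"
      using a that assms by (auto simp: centraliser_def)
    then show ?thesis
      by (metis inv_closed inv_solve_left inv_solve_right m_assoc m_closed)
  qed
  then show "inv a \<in> centraliser G W" using a by (auto simp: centraliser_def)
next
  fix a b assume ab: "a \<in> centraliser G W" "b \<in> centraliser G W"
  have "a \<otimes> b \<otimes> w = w \<otimes> (a \<otimes> b)" if "w \<in> W" for w
  proof -
    have "a \<in> carrier G" "b \<in> carrier G" "w \<in> carrier G" "a \<otimes> w = w \<otimes> a" "b \<otimes> w = w \<otimes> b"
      using ab that assms by (auto simp: centraliser_def)
    then show ?thesis by (metis m_assoc)
  qed
  then show "a \<otimes> b \<in> centraliser G W" using ab by (auto simp: centraliser_def)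
qed

lemma (in group) conj_eq_imp_commute:
  assumes "t \<in> carrier G" "g \<in> carrier G" "w \<in> carrier G"
    and "t \<otimes> w \<otimes> inv t = g \<otimes> w \<otimes> inv g"
  shows "(inv t \<otimes> g) \<otimes> w = w \<otimes> (inv t \<otimes> g)"
proof -
  have "t \<otimes> w \<otimes> inv t \<otimes> g = g \<otimes> w"
    using assms by (simp add: m_assoc)
  then have "inv t \<otimes> (t \<otimes> (w \<otimes> (inv t \<otimes> g))) = inv t \<otimes> (g \<otimes> w)"
    using assms(1-3) by (simp add: m_assoc)
  then show ?thesis
    using assms(1-3) by (simp add: m_assoc[symmetric])
qed

text \<open>
  Two elements conjugating every \<open>w \<in> W\<close> in the same way differ by an element of the centraliser,
  and the map recording these conjugates takes only finitely many values. One preimage of each value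
  gives the transversal.
\<close>

lemma (in group) finite_transversal_centraliser:
  assumes "finite W" and "W \<subseteq> FC G"
  obtains T where "finite T" "T \<subseteq> carrier G" "carrier G \<subseteq> T <#> centraliser G W"
proof -
  define c where "c g = (\<lambda>w\<in>W. g \<otimes> w \<otimes> inv g)" for g
  have "c ` carrier G \<subseteq> (\<Pi>\<^sub>E w\<in>W. conj_class G w)"
    using assms(2) unfolding c_def FC_def by (fastforce simp: conj_class_eq)
  moreover have "finite (\<Pi>\<^sub>E w\<in>W. conj_class G w)"
    using assms by (intro finite_PiE) (auto simp: FC_def)
  ultimately have "finite (c ` carrier G)"
    by (rule finite_subset)
  then obtain T where T: "T \<subseteq> carrier G" "finite T" "c ` carrier G = c ` T"
    using finite_subset_image[of "c ` carrier G" c "carrier G"] by blast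
  have "carrier G \<subseteq> T <#> centraliser G W"
  proof
    fix g assume g: "g \<in> carrier G"
    then obtain t where t: "t \<in> T" "c t = c g" using T(3) by (metis imageE imageI)
    have tc: "t \<in> carrier G" using t T by auto
    have "(inv t \<otimes> g) \<otimes> w = w \<otimes> (inv t \<otimes> g)" if w: "w \<in> W" for w
    proof (rule conj_eq_imp_commute[OF tc g])
      show "w \<in> carrier G" using w assms(2) by (auto simp: FC_def)
      show "t \<otimes> w \<otimes> inv t = g \<otimes> w \<otimes> inv g"
        using fun_cong[OF t(2), of w] w by (simp add: c_def)
    qed
    then have "inv t \<otimes> g \<in> centraliser G W" using tc g by (auto simp: centraliser_def)
    moreover have "g = t \<otimes> (inv t \<otimes> g)" using tc g by (simp add: m_assoc[symmetric])
    ultimately show "g \<in> T <#> centraliser G W" using t(1) by (auto simp: set_mult_def)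
  qed
  with T that show thesis by blast
qed

theorem proposition4p4:
  fixes G :: "('a, 'b) monoid_scheme" (structure)
    and y :: 'a and Y W E F :: "'a set"
  assumes "group G"
    and "y \<in> carrier G" and "Y = conj_class G y" and "infinite Y"
    and "finite W" and "W \<subseteq> FC G"
    and "finite E" and "E \<subseteq> Y"
    and "finite F" and "F \<subseteq> Y"
  shows "\<exists>g \<in> centraliser G W. (g <# E #> inv g) \<inter> F = {}"
proof -
  interpret group G by fact
  define \<phi> where "\<phi> = (\<lambda>g. \<lambda>h \<in> carrier G. g \<otimes> h \<otimes> inv g)"
  define C where "C = centraliser G W"
  interpret conj: group_action G "carrier G" \<phi>
    unfolding \<phi>_def by (rule action_by_conjugation)
  have C: "subgroup C G"
    unfolding C_def using assms(6) by (intro centraliser_subgroup) (auto simp: FC_def)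
  interpret C_conj: group_action "G\<lparr>carrier := C\<rparr>" "carrier G" \<phi>
    by (rule conj.induced_action[OF C])
  have Y: "Y = orbit G \<phi> y" using assms(3) by (simp add: conj_class_def \<phi>_def)
  have YG: "Y \<subseteq> carrier G"
    unfolding Y orbit_def using conj.element_image[OF _ assms(2) refl] by auto
  obtain T where T: "finite T" "T \<subseteq> carrier G" "carrier G \<subseteq> T <#> C"
    using finite_transversal_centraliser[OF assms(5,6)] unfolding C_def by blast
  have "infinite (orbit (G\<lparr>carrier := C\<rparr>) \<phi> e)" if "e \<in> E" for e
  proof (rule conj.infinite_orbit_finite_index[OF C T])
    have eY: "e \<in> orbit G \<phi> y" and e: "e \<in> carrier G" using that assms(8) Y YG by auto
    show "e \<in> carrier G" by fact
    have "y \<in> orbit G \<phi> e" using conj.orbit_sym[OF assms(2) e eY] .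
    then have "Y \<subseteq> orbit G \<phi> e"
      using conj.orbit_trans[OF e assms(2)] YG Y by blast
    then show "infinite (orbit G \<phi> e)" using assms(4) finite_subset by blast
  qed
  then obtain g where g: "g \<in> C" "\<phi> g ` E \<inter> F = {}"
    using C_conj.separate_finite_sets[of E F] assms(7-9) YG by auto
  have "g <# E #> inv g = \<phi> g ` E"
    using assms(8) YG by (auto simp: l_coset_def r_coset_def \<phi>_def)
  with g show ?thesis unfolding C_def by (intro bexI[of _ g]) simp_all
qed

end
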